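(* Let $\bm\alpha\in\mathbb R_+^n$ with $\bm 1^\top\bm\alpha=1$ be a fixed participation vector, and let $A_\alpha = I-\bm\alpha\bm 1^\top\in\mathbb R^{n\times n}$. For a scheduled injection $\bar{\bm p}\in\mathbb R^n$ with $\bm 1^\top\bar{\bm p}=0$ and a random forecast error $\bm\omega\in\mathbb R^n$, let the post-balancing injection under the AGC policy be $\bm p^{\mathrm{actual}}=\bar{\bm p}+\bm\omega-\bm\alpha(\bm 1^\top\bm\omega)$, and let the post-AGC residual injection be $\bm r=\bm p^{\mathrm{actual}}-\bar{\bm p}$. Suppose that the distribution of $\bm\omega$ is exogenous to the scheduled injection (i.e. the law of $\bm\omega$ is the same for every choice of $\bar{\bm p}$), and that the same fixed, unsaturated AGC policy $A_\alpha$ applies before and after a change in $\bar{\bm p}$ (i.e. the formula for $\bm p^{\mathrm{actual}}$ above holds with the same $\bm\alpha$ for every $\bar{\bm p}$ considered). Then the distribution of $\bm r$, and consequently its mean $\bm\mu_r=\mathbb E[\bm r]$ and its covariance $\Sigma_{\tilde r}=\mathbb E[\tilde{\bm r}\tilde{\bm r}^\top]$ with $\tilde{\bm r}=\bm r-\bm\mu_r$, is invariant to $\bar{\bm p}$: it is the same for all scheduled injections $\bar{\bm p}$.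
   Context: $\bm 1\in\mathbb R^n$ is the all-ones vector and $I$ the $n\times n$ identity. AGC (automatic generation control) is the balancing rule that, given the realized forecast error $\bm\omega$, adds the adjustment $-\bm\alpha(\bm 1^\top\bm\omega)$ to the pre-balancing injection $\bar{\bm p}+\bm\omega$; "unsaturated" means that this adjustment is applied in full, without clipping. The forecast error $\bm\omega$ is assumed to have finite second moments, so that $\bm\mu_r$ and $\Sigma_{\tilde r}$ are defined. *)

theory Defs
  imports "HOL-Probability.Probability"
begin

definition outer_product :: "real ^ 'n \<Rightarrow> real ^ 'm \<Rightarrow> real ^ 'm ^ 'n" where
  "outer_product u v = (\<chi> i j. u $ i * v $ j)"

text \<open>On vectors, the constant \<open>1\<close> is the all-ones vector, so \<open>1 \<bullet> v\<close> is the sum of the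
  entries of \<open>v\<close>.\<close>

definition participation_vector :: "real ^ 'n \<Rightarrow> bool" where
  "participation_vector \<alpha> \<longleftrightarrow> (\<forall>i. 0 \<le> \<alpha> $ i) \<and> 1 \<bullet> \<alpha> = 1"

definition agc_matrix :: "real ^ 'n \<Rightarrow> real ^ 'n ^ 'n" where
  "agc_matrix \<alpha> = mat 1 - outer_product \<alpha> 1"

definition scheduled_injections :: "(real ^ 'n) set" where
  "scheduled_injections = {p. 1 \<bullet> p = 0}"

definition agc_injection :: "real ^ 'n \<Rightarrow> real ^ 'n \<Rightarrow> real ^ 'n \<Rightarrow> real ^ 'n" where
  "agc_injection \<alpha> p w = p + w - (1 \<bullet> w) *\<^sub>R \<alpha>"

definition law :: "'w measure \<Rightarrow> ('w \<Rightarrow> real ^ 'n) \<Rightarrow> (real ^ 'n) measure" where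
  "law M X = distr M borel X"

definition finite_second_moments :: "'w measure \<Rightarrow> ('w \<Rightarrow> real ^ 'n) \<Rightarrow> bool" where
  "finite_second_moments M X \<longleftrightarrow> integrable M (\<lambda>x. (norm (X x))\<^sup>2)"

definition mean_vector :: "'w measure \<Rightarrow> ('w \<Rightarrow> real ^ 'n) \<Rightarrow> real ^ 'n" where
  "mean_vector M X = (LINT x|M. X x)"

definition covariance_matrix :: "'w measure \<Rightarrow> ('w \<Rightarrow> real ^ 'n) \<Rightarrow> real ^ 'n ^ 'n" where
  "covariance_matrix M X =
     (LINT x|M. outer_product (X x - mean_vector M X) (X x - mean_vector M X))"

end

theory Submission
  imports Defs
begin

text \<open>The schedule cancels in the residual: what remains is \<open>\<omega> p x\<close> minus
  the balancing adjustment, that is \<open>A *v \<omega> p x\<close> by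
  \<open>agc_matrix_mult_vector\<close>. So the residual is the image of the forecast error under
  one linear map that does not depend on \<open>p\<close>, and its law is the pushforward under this
  map of the error law common to all schedules (\<open>law_comp\<close>). Mean and covariance are
  functionals of the law (\<open>mean_vector_law\<close>, \<open>covariance_matrix_law\<close>), so
  they agree too. As \<open>M p\<close> may vary with \<open>p\<close>, residuals for different
  schedules can be compared only through their laws.\<close>

lemma agc_matrix_mult_vector: "agc_matrix \<alpha> *v w = w - (1 \<bullet> w) *\<^sub>R \<alpha>"
proof -
  have "outer_product \<alpha> 1 *v w = (1 \<bullet> w) *\<^sub>R \<alpha>"
    by (simp add: vec_eq_iff outer_product_def matrix_vector_mult_def inner_vec_def
        mult.commute flip: sum_distrib_left)
  then show ?thesis
    by (simp add: agc_matrix_def matrix_vector_mult_diff_rdistrib)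
qed

lemma borel_measurable_matrix_vector_mult [measurable]:
  fixes A :: "real ^ 'n ^ 'm"
  shows "(\<lambda>v. A *v v) \<in> borel_measurable borel"
  by (intro borel_measurable_continuous_onI matrix_vector_mult_linear_continuous_on)

text \<open>The entries are polynomials in \<open>v\<close>, so the map is continuous; this makes
  the covariance integrand admissible for a change of variables.\<close>

lemma borel_measurable_outer_product_self:
  fixes c :: "real ^ 'n"
  shows "(\<lambda>v. outer_product (v - c) (v - c)) \<in> borel_measurable borel"
  unfolding outer_product_def
  by (intro borel_measurable_continuous_onI continuous_intros)

lemma law_comp:
  assumes "X \<in> borel_measurable M" and "g \<in> borel_measurable borel"
  shows "law M (\<lambda>x. g (X x)) = distr (law M X) borel g"
  using assms by (simp add: law_def distr_distr comp_def)

text \<open>Change of variables to the image measure; for a non-integrable \<open>X\<close> both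
  integrals take the default value 0.\<close>

lemma mean_vector_law:
  assumes "X \<in> borel_measurable M"
  shows "mean_vector M X = (LINT v|law M X. v)"
  using assms by (simp add: mean_vector_def law_def integral_distr)

text \<open>The same change of variables, with the centre \<open>mean_vector M X\<close> treated as
  a constant; by \<open>mean_vector_law\<close> this centre is itself determined by the law.\<close>

lemma covariance_matrix_law:
  assumes "X \<in> borel_measurable M"
  shows "covariance_matrix M X =
    (LINT v|law M X. outer_product (v - mean_vector M X) (v - mean_vector M X))"
  using assms
  by (simp add: covariance_matrix_def law_def integral_distr borel_measurable_outer_product_self)

theorem proposition1:
  fixes \<alpha> :: "real ^ 'n"
    and A :: "real ^ 'n ^ 'n"
    and M :: "real ^ 'n \<Rightarrow> 'w measure"
    and \<omega> p_actual r :: "real ^ 'n \<Rightarrow> 'w \<Rightarrow> real ^ 'n"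
  assumes alpha: "participation_vector \<alpha>"
    and A_def: "A = agc_matrix \<alpha>"
    and prob: "\<And>p. p \<in> scheduled_injections \<Longrightarrow> prob_space (M p)"
    and random: "\<And>p. p \<in> scheduled_injections \<Longrightarrow> \<omega> p \<in> borel_measurable (M p)"
    and moments: "\<And>p. p \<in> scheduled_injections \<Longrightarrow> finite_second_moments (M p) (\<omega> p)"
    and exogenous: "\<And>p q. p \<in> scheduled_injections \<Longrightarrow> q \<in> scheduled_injections \<Longrightarrow>
      law (M p) (\<omega> p) = law (M q) (\<omega> q)"
    and policy: "\<And>p x. p \<in> scheduled_injections \<Longrightarrow> x \<in> space (M p) \<Longrightarrow>
      p_actual p x = agc_injection \<alpha> p (\<omega> p x)"
    and residual: "\<And>p x. p \<in> scheduled_injections \<Longrightarrow> x \<in> space (M p) \<Longrightarrow>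
      r p x = p_actual p x - p"
  shows "\<forall>p \<in> scheduled_injections. \<forall>q \<in> scheduled_injections.
      law (M p) (r p) = law (M q) (r q) \<and>
      mean_vector (M p) (r p) = mean_vector (M q) (r q) \<and>
      covariance_matrix (M p) (r p) = covariance_matrix (M q) (r q)"
proof (intro ballI)
  fix p q :: "real ^ 'n"
  assume p: "p \<in> scheduled_injections" and q: "q \<in> scheduled_injections"
  have r_eq: "r s x = A *v \<omega> s x" if "s \<in> scheduled_injections" "x \<in> space (M s)" for s x
    using that by (simp add: residual policy agc_injection_def A_def agc_matrix_mult_vector)
  have r_measurable: "r s \<in> borel_measurable (M s)" if s: "s \<in> scheduled_injections" for s
  proof -
    note random[OF s, measurable]
    have "(\<lambda>x. A *v \<omega> s x) \<in> borel_measurable (M s)"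
      by measurable
    then show ?thesis
      \<comment> \<open>\<open>r s\<close> is known to equal \<open>A *v \<omega> s x\<close> only
        on \<open>space (M s)\<close>, which suffices for measurability and, below, for the
        law.\<close>
      by (simp add: r_eq s cong: measurable_cong)
  qed
  \<comment> \<open>The right-hand side depends on \<open>s\<close> only through the law of
    \<open>\<omega> s\<close>, which is where exogeneity enters.\<close>
  have r_law: "law (M s) (r s) = distr (law (M s) (\<omega> s)) borel (\<lambda>v. A *v v)"
    if s: "s \<in> scheduled_injections" for s
  proof -
    have "law (M s) (r s) = law (M s) (\<lambda>x. A *v \<omega> s x)"
      unfolding law_def by (intro distr_cong) (simp_all add: r_eq s)
    then show ?thesis
      by (simp add: law_comp random[OF s])
  qed
  have law_eq: "law (M p) (r p) = law (M q) (r q)"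
    using exogenous[OF p q] by (simp add: r_law p q)
  then have mean_eq: "mean_vector (M p) (r p) = mean_vector (M q) (r q)"
    by (simp add: mean_vector_law r_measurable p q)
  \<comment> \<open>Equal laws give the same integrating measure, equal means the same centre in the
    integrand.\<close>
  have "covariance_matrix (M p) (r p) = covariance_matrix (M q) (r q)"
    by (simp add: covariance_matrix_law r_measurable p q law_eq mean_eq)
  with law_eq mean_eq show "law (M p) (r p) = law (M q) (r q) \<and>
      mean_vector (M p) (r p) = mean_vector (M q) (r q) \<and>
      covariance_matrix (M p) (r p) = covariance_matrix (M q) (r q)"
    by blast
qed

end
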